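(* For every integer $n\ge 4$, $$\sum_{i=1}^{n-4} (n-i)(-1)^iF_i+4(-1)^{n-3}F_{n-3}=(-1)^{n-1}F_{n-1}-(n-2).$$
   Context: The Fibonacci numbers are $F_1=F_2=1$ and $F_k=F_{k-1}+F_{k-2}$ for $k\ge 3$. An empty sum equals $0$. *)

theory Defs
  imports Complex_Main "HOL-Number_Theory.Fib"
begin

end

theory Submission
  imports Defs
begin

text \<open>Raising \<open>n\<close> by one raises each weight by one, so the weighted sum grows by
  the plain alternating sum, which has a closed form, and by one new term. Induction then needs only
  the Fibonacci recurrence.\<close>

text \<open>The difference equals F_{m-1} for m \<ge> 1; this form also covers
  \<open>m = 0\<close>.\<close>

lemma sum_alternating_fib:
  "(\<Sum>i = 1..m. (-1) ^ i * int (fib i)) = (-1) ^ m * (int (fib (m + 1)) - int (fib m)) - 1"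
  by (induction m) (auto simp: algebra_simps)

text \<open>Putting \<open>n = m + 4\<close> removes truncated subtraction from the
  induction.\<close>

lemma sum_weighted_alternating_fib:
  "(\<Sum>i = 1..m. (int m + 4 - int i) * (-1) ^ i * int (fib i))
     + 4 * (-1) ^ (m + 1) * int (fib (m + 1))
   = (-1) ^ (m + 3) * int (fib (m + 3)) - (int m + 2)"
proof (induction m)
  case 0
  show ?case by (simp add: numeral_eq_Suc)
next
  case (Suc m)
  \<comment> \<open>The new index \<open>m + 1\<close> has weight 4, so its term is exactly the
    boundary term of the induction hypothesis.\<close>
  have "(\<Sum>i = 1..Suc m. (int (Suc m) + 4 - int i) * (-1) ^ i * int (fib i))
      = (\<Sum>i = 1..m. (int m + 4 - int i) * (-1) ^ i * int (fib i))
        + (\<Sum>i = 1..m. (-1) ^ i * int (fib i)) + 4 * (-1) ^ (m + 1) * int (fib (m + 1))"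
    by (simp add: sum.distrib [symmetric] algebra_simps)
  \<comment> \<open>Up to sign, what remains is 4F_{m+2} - F_{m+3} + F_{m+1} - F_m =
    F_{m+4}.\<close>
  with Suc.IH show ?case
    unfolding sum_alternating_fib by (simp add: numeral_eq_Suc algebra_simps)
qed

theorem corollary3p1:
  fixes n :: nat
  assumes "n \<ge> 4"
  shows "(\<Sum>i = 1..n - 4. (int n - int i) * (-1) ^ i * int (fib i))
           + 4 * (-1) ^ (n - 3) * int (fib (n - 3))
         = (-1) ^ (n - 1) * int (fib (n - 1)) - (int n - 2)"
proof -
  from assms obtain m where "n = m + 4"
    using le_Suc_ex by (metis add.commute)
  moreover from this have "n - 3 = m + 1" "n - 1 = m + 3" "n - 4 = m"
    by simp_all
  ultimately show ?thesis
    using sum_weighted_alternating_fib [of m] by (simp add: add.commute [of 3])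
qed

end
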